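(* For any $r\in(0,1)$, let $$v_m=\max\Big\{\Big\lfloor\frac m2+\frac{\sqrt m}{2}Q^{-1}(1-r)\Big\rfloor,0\Big\}.$$ Then the rate $r_m$ of $\mathrm{RM}(v_m,m)$ satisfies $r_m\to r$ as $m\to\infty$, and the sequence $\{\mathrm{RM}(v_m,m)\}_m$ is capacity achieving on the BEC under bit-MAP decoding.
   Context: $Q(t)=\frac1{\sqrt{2\pi}}\int_t^\infty e^{-\tau^2/2}d\tau$. $\mathrm{RM}(v,m)$ is the binary code of length $N=2^m$ consisting of the evaluation vectors $(f(\underline{x}))_{\underline{x}\in\{0,1\}^m}$ of all polynomials $f$ over $\mathbb{F}_2$ in the span of multilinear monomials in $x_1,\dots,x_m$ of degree at most $v$; its rate is $2^{-m}\sum_{k=0}^v\binom mk$. A uniform codeword $\underline{X}$ is sent over $\mathrm{BEC}(p)$ (each bit erased independently with probability $p$), giving $\underline{Y}$; $P_b(p)=\frac1N\sum_i\Pr(X_i\text{ not uniquely determined by }\underline{Y})$. A code sequence with rates $r_n\to r\in(0,1)$ is capacity achieving under bit-MAP decoding if $P_b^{(n)}(p)\to0$ for every $p\in[0,1-r)$. *)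

theory Defs
  imports "HOL-Analysis.Analysis"
begin

text \<open>Gaussian tail function Q and its inverse (Q is a strictly decreasing bijection onto (0,1)).\<close>
definition Qfun :: "real \<Rightarrow> real" where
  "Qfun t = integral {t..} (\<lambda>\<tau>. exp (-(\<tau>^2) / 2)) / sqrt (2 * pi)"

definition Qinv :: "real \<Rightarrow> real" where
  "Qinv y = (THE t. Qfun t = y)"

text \<open>Points of {0,1}^m are encoded by their supports x \<subseteq> {..<m}.
  The multilinear monomial x_T (T \<subseteq> {..<m}) evaluates to 1 at x iff T \<subseteq> x.
  A polynomial over F_2 in the span of monomials of degree \<le> v is a sum of a set A of
  such monomials; its value at x is the parity of the number of monomials in A equal to 1.
  A codeword is a function on coordinates (points), taking False outside Pow {..<m}.\<close>
definition RM_monomials :: "nat \<Rightarrow> nat \<Rightarrow> nat set set" where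
  "RM_monomials v m = {T. T \<subseteq> {..<m} \<and> card T \<le> v}"

definition RM_coords :: "nat \<Rightarrow> nat set set" where
  "RM_coords m = Pow {..<m}"

definition RM_code :: "nat \<Rightarrow> nat \<Rightarrow> (nat set \<Rightarrow> bool) set" where
  "RM_code v m = {(\<lambda>x. x \<subseteq> {..<m} \<and> odd (card {T\<in>A. T \<subseteq> x})) | A. A \<subseteq> RM_monomials v m}"

definition RM_rate :: "nat \<Rightarrow> nat \<Rightarrow> real" where
  "RM_rate v m = (\<Sum>k=0..v. real (m choose k)) / 2 ^ m"

text \<open>Bit error probability of bit-MAP decoding of a uniformly chosen codeword of code C
  (coordinate set I) over BEC(p). E is the set of erased positions; bit i of X is not
  uniquely determined by Y iff some codeword agreeing with X on all unerased positions
  differs from X at position i.\<close>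
definition bit_MAP_Pb :: "'i set \<Rightarrow> ('i \<Rightarrow> bool) set \<Rightarrow> real \<Rightarrow> real" where
  "bit_MAP_Pb I C p =
     (1 / real (card I)) * (\<Sum>i\<in>I. \<Sum>E\<in>Pow I.
        p ^ card E * (1 - p) ^ (card I - card E) *
        ((1 / real (card C)) *
          real (card {X\<in>C. \<exists>c\<in>C. (\<forall>j\<in>I - E. c j = X j) \<and> c i \<noteq> X i})))"

definition capacity_achieving_BEC ::
    "(nat \<Rightarrow> real) \<Rightarrow> (nat \<Rightarrow> real \<Rightarrow> real) \<Rightarrow> real \<Rightarrow> bool" where
  "capacity_achieving_BEC rate Pb r \<longleftrightarrow>
     rate \<longlonglongrightarrow> r \<and> (\<forall>p. 0 \<le> p \<and> p < 1 - r \<longrightarrow> (\<lambda>n. Pb n p) \<longlonglongrightarrow> 0)"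

end

theory Submission
  imports Defs "HOL-Probability.Probability" "HOL-Real_Asymp.Real_Asymp"
begin

text \<open>
  Let \<open>h_m\<close> be the EXIT function of \<open>RM(v,m)\<close>: the probability that the bit at the origin is not
  determined by the unerased bits at the other positions. The area theorem says
  \<open>\<integral> h_m = rate\<close>, and \<open>P_b \<le> h_m\<close>; as \<open>h_m\<close> is nondecreasing,
  \<open>h_m(p) (1 - p - r_m) \<le> \<integral> h_m (1 - h_m)\<close>, so it suffices that \<open>\<integral> h_m (1 - h_m) \<rightarrow> 0\<close>.

  Conditioning on the erasures in a subcube \<open>S\<close> of
  codimension \<open>j\<close> bounds the variance \<open>h_m (1 - h_m)\<close> by two terms. Resampling the erasures outside
  \<open>S\<close> costs at most \<open>h_{m-j} - h_m\<close>, since \<open>RM(v,m)\<close> restricts to \<open>RM(v,m-j)\<close> on \<open>S\<close>; the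
  integral of this is a difference of rates, which is \<open>O(j / \<surd>m)\<close>. Resampling those in \<open>S\<close> costs at most
  the sum of the influences of the points of \<open>S\<close>. The transvections act transitively on the
  nonzero points, so all influences are equal, and by the Margulis--Russo formula this sum is at most
  \<open>2^{-j} h_m'\<close>, whose integral is at most \<open>2^{-j}\<close>. Now let \<open>m \<rightarrow> \<infinity>\<close>, then \<open>j \<rightarrow> \<infinity>\<close>.
\<close>

section \<open>Expectation over random erasure sets\<close>

text \<open>The random set contains each element of \<open>V\<close> independently with probability
  \<open>p\<close>. Writing the expectation as a finite sum makes it a polynomial in
  \<open>p\<close>, ready to be differentiated and integrated.\<close>

definition bexp :: "'a set \<Rightarrow> real \<Rightarrow> ('a set \<Rightarrow> real) \<Rightarrow> real" where
  "bexp V p f = (\<Sum>E\<in>Pow V. p ^ card E * (1 - p) ^ (card V - card E) * f E)"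

text \<open>For a monotone 0/1-valued \<open>f\<close> this indicates that \<open>i\<close> is
  pivotal at \<open>E\<close>, and its expectation is the influence of \<open>i\<close>.\<close>

definition discrete_deriv :: "'a \<Rightarrow> ('a set \<Rightarrow> real) \<Rightarrow> 'a set \<Rightarrow> real" where
  "discrete_deriv i f E = f (insert i E) - f (E - {i})"

lemma bexp_empty [simp]: "bexp {} p f = f {}"
  by (simp add: bexp_def)

lemma bexp_cong: "(\<And>E. E \<subseteq> V \<Longrightarrow> f E = g E) \<Longrightarrow> bexp V p f = bexp V p g"
  unfolding bexp_def by (intro sum.cong) auto

text \<open>Conditioning on whether \<open>a\<close> is erased. This recursion drives the inductions
  on the index set below.\<close>

lemma bexp_insert:
  assumes "finite V" "a \<notin> V"
  shows "bexp (insert a V) p f = p * bexp V p (\<lambda>E. f (insert a E)) + (1 - p) * bexp V p f"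
proof -
  have inj: "inj_on (insert a) (Pow V)"
    using assms(2) by (intro inj_onI) (metis PowD insert_ident subsetD)
  have disj: "Pow V \<inter> insert a ` Pow V = {}" using assms(2) by auto
  have c: "card E \<le> card V" "a \<notin> E" "finite E" if "E \<in> Pow V" for E
    using that assms by (auto intro: card_mono finite_subset)
  have "bexp (insert a V) p f =
      (\<Sum>E\<in>Pow V. p ^ card E * (1 - p) ^ (Suc (card V) - card E) * f E)
    + (\<Sum>E\<in>Pow V. p ^ card (insert a E) * (1 - p) ^ (Suc (card V) - card (insert a E)) * f (insert a E))"
    unfolding bexp_def Pow_insert using assms inj disj
    by (subst sum.union_disjoint) (auto simp: sum.reindex)
  also have "(\<Sum>E\<in>Pow V. p ^ card E * (1 - p) ^ (Suc (card V) - card E) * f E) = (1 - p) * bexp V p f"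
    unfolding bexp_def sum_distrib_left
    by (intro sum.cong) (auto simp: Suc_diff_le c(1))
  also have "(\<Sum>E\<in>Pow V. p ^ card (insert a E) * (1 - p) ^ (Suc (card V) - card (insert a E)) * f (insert a E))
     = p * bexp V p (\<lambda>E. f (insert a E))"
    unfolding bexp_def sum_distrib_left
    by (intro sum.cong) (auto simp: c(2,3))
  finally show ?thesis by simp
qed

lemma bexp_diff: "bexp V p (\<lambda>E. f E - g E) = bexp V p f - bexp V p g"
  by (simp add: bexp_def sum_subtractf algebra_simps)

lemma bexp_const: "finite V \<Longrightarrow> bexp V p (\<lambda>_. c) = c"
  by (induction V rule: finite_induct) (simp_all add: bexp_insert algebra_simps)

lemma bexp_mono:
  assumes "0 \<le> p" "p \<le> 1" "\<And>E. E \<subseteq> V \<Longrightarrow> f E \<le> g E"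
  shows "bexp V p f \<le> bexp V p g"
  unfolding bexp_def using assms by (intro sum_mono mult_left_mono) auto

lemma bexp_bounds:
  assumes "finite V" "0 \<le> p" "p \<le> 1" "\<And>E. E \<subseteq> V \<Longrightarrow> f E \<in> {0..1}"
  shows "bexp V p f \<in> {0..1}"
  using bexp_mono[of p V "\<lambda>_. 0" f] bexp_mono[of p V f "\<lambda>_. 1"] assms
  by (simp add: bexp_const)

lemma bexp_at_0: "finite V \<Longrightarrow> bexp V 0 f = f {}"
  by (induction V arbitrary: f rule: finite_induct) (simp_all add: bexp_insert)

lemma bexp_at_1: "finite V \<Longrightarrow> bexp V 1 f = f V"
  by (induction V arbitrary: f rule: finite_induct) (simp_all add: bexp_insert)

lemma bexp_Un:
  assumes "finite S" "finite T" "S \<inter> T = {}"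
  shows "bexp (S \<union> T) p f = bexp S p (\<lambda>A. bexp T p (\<lambda>B. f (A \<union> B)))"
  using assms(1,3)
proof (induction S arbitrary: f rule: finite_induct)
  case (insert a S)
  have "bexp (insert a (S \<union> T)) p f =
      p * bexp (S \<union> T) p (\<lambda>E. f (insert a E)) + (1 - p) * bexp (S \<union> T) p f"
    using insert assms(2) by (intro bexp_insert) auto
  then show ?case using insert by (simp add: bexp_insert)
qed simp

lemma bexp_reindex:
  assumes "bij_betw \<phi> V V"
  shows "bexp V p (\<lambda>E. f (\<phi> ` E)) = bexp V p f"
proof -
  have "bij_betw ((`) \<phi>) (Pow V) (Pow V)" using assms by (rule bij_betw_Pow)
  then show ?thesis unfolding bexp_def
    by (subst sum.reindex_bij_betw[symmetric, of "(`) \<phi>" "Pow V" "Pow V"])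
       (auto intro!: sum.cong simp: card_image inj_on_subset[OF bij_betw_imp_inj_on[OF assms]])
qed

lemma bexp_insert_deriv_self:
  assumes "finite V" "a \<notin> V"
  shows "bexp (insert a V) p (discrete_deriv a f) = bexp V p (\<lambda>E. f (insert a E)) - bexp V p f"
proof -
  have "bexp V p (\<lambda>E. discrete_deriv a f (insert a E)) = bexp V p (\<lambda>E. f (insert a E) - f E)"
       "bexp V p (discrete_deriv a f) = bexp V p (\<lambda>E. f (insert a E) - f E)"
    using assms by (auto intro!: bexp_cong arg_cong[where f = f] simp: discrete_deriv_def)
  then show ?thesis using bexp_insert[OF assms, of p "discrete_deriv a f"]
    by (simp only: bexp_diff) (simp add: algebra_simps)
qed

lemma bexp_insert_deriv_other:
  assumes "finite V" "a \<notin> V" "i \<in> V"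
  shows "bexp (insert a V) p (discrete_deriv i f) =
    p * bexp V p (discrete_deriv i (\<lambda>E. f (insert a E))) + (1 - p) * bexp V p (discrete_deriv i f)"
proof -
  have "i \<noteq> a" using assms by auto
  then have "(\<lambda>E. discrete_deriv i f (insert a E)) = discrete_deriv i (\<lambda>E. f (insert a E))"
    by (auto simp: discrete_deriv_def fun_eq_iff insert_commute insert_Diff_if)
  then show ?thesis using assms by (simp add: bexp_insert)
qed

text \<open>Differentiate the recursion \<open>bexp_insert\<close>. The explicit factors
  \<open>p\<close> and \<open>1 - p\<close> contribute the difference of the two conditional
  expectations, which is the summand of the new element \<open>a\<close>; the remaining terms are
  the old summands, split by conditioning on \<open>a\<close>.\<close>

lemma Margulis_Russo:
  assumes "finite V"
  shows "((\<lambda>p. bexp V p f) has_real_derivative (\<Sum>i\<in>V. bexp V p (discrete_deriv i f))) (at p)"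
  using assms
proof (induction V arbitrary: f rule: finite_induct)
  case (insert a V)
  let ?g = "\<lambda>E. f (insert a E)"
  have D: "((\<lambda>p. p * bexp V p ?g + (1 - p) * bexp V p f) has_real_derivative
      bexp V p ?g - bexp V p f + p * (\<Sum>i\<in>V. bexp V p (discrete_deriv i ?g))
        + (1 - p) * (\<Sum>i\<in>V. bexp V p (discrete_deriv i f))) (at p)"
    by (rule derivative_eq_intros insert.IH refl)+ (simp add: algebra_simps)
  have "(\<Sum>i\<in>insert a V. bexp (insert a V) p (discrete_deriv i f)) =
      bexp V p ?g - bexp V p f + p * (\<Sum>i\<in>V. bexp V p (discrete_deriv i ?g))
        + (1 - p) * (\<Sum>i\<in>V. bexp V p (discrete_deriv i f))"
    using insert by (auto simp: bexp_insert_deriv_self bexp_insert_deriv_other sum.distrib sum_distrib_left intro!: sum.cong)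
  with D show ?case using insert by (simp add: bexp_insert)
qed simp

lemma continuous_on_bexp: "continuous_on A (\<lambda>p. bexp V p f)"
  unfolding bexp_def by (intro continuous_intros)

text \<open>Almost surely the random set is empty at \<open>p = 0\<close> and all of
  \<open>V\<close> at \<open>p = 1\<close>, so these are the boundary values of the
  antiderivative.\<close>

lemma bexp_has_integral_deriv:
  assumes "finite V"
  shows "((\<lambda>p. \<Sum>i\<in>V. bexp V p (discrete_deriv i f)) has_integral (f V - f {})) {0..1}"
  using fundamental_theorem_of_calculus[of 0 1 "\<lambda>p. bexp V p f" "\<lambda>p. \<Sum>i\<in>V. bexp V p (discrete_deriv i f)"]
    Margulis_Russo[OF assms] assms
  by (auto simp: has_real_derivative_iff_has_vector_derivative[symmetric] bexp_at_0 bexp_at_1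
      intro: has_field_derivative_at_within)

lemma discrete_deriv_nonneg:
  assumes "mono f"
  shows "0 \<le> discrete_deriv i f E"
  using monoD[OF assms, of "E - {i}" "insert i E"] by (auto simp: discrete_deriv_def)

lemma bexp_mono_prob:
  assumes "finite V" "mono f" "0 \<le> p" "p \<le> q" "q \<le> 1"
  shows "bexp V p f \<le> bexp V q f"
proof (rule DERIV_nonneg_imp_nondecreasing[OF assms(4)])
  fix x assume x: "p \<le> x" "x \<le> q"
  have "0 \<le> (\<Sum>i\<in>V. bexp V x (discrete_deriv i f))"
    using bexp_mono[of x V "\<lambda>_. 0"] discrete_deriv_nonneg[OF assms(2)] assms x
    by (intro sum_nonneg) (auto simp: bexp_const)
  then show "\<exists>y. ((\<lambda>p. bexp V p f) has_real_derivative y) (at x) \<and> 0 \<le> y"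
    using Margulis_Russo[OF assms(1)] by blast
qed

text \<open>An Efron-Stein bound by induction. Conditioning on \<open>a\<close>, the variance is the
  mean of the conditional variances plus \<open>p * (1 - p) * (?e1 - ?e0)\<^sup>2\<close>. By
  monotonicity \<open>?e1 - ?e0\<close> lies in [0,1], so the last term is at most
  \<open>?e1 - ?e0\<close>, the influence of \<open>a\<close>.\<close>

lemma bexp_variance_le:
  assumes "finite S" "mono g" "\<And>E. g E \<in> {0..1}" "0 \<le> p" "p \<le> 1"
  shows "bexp S p (\<lambda>E. (g E)\<^sup>2) - (bexp S p g)\<^sup>2 \<le> (\<Sum>i\<in>S. bexp S p (discrete_deriv i g))"
  using assms(1-3)
proof (induction S arbitrary: g rule: finite_induct)
  case (insert a S)
  let ?g = "\<lambda>E. g (insert a E)"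
  have mono: "mono ?g" using insert.prems(1) by (auto intro!: monoI elim: monoD)
  let ?e0 = "bexp S p g" and ?e1 = "bexp S p ?g"
  have e: "?e0 \<le> ?e1"
    using assms(4,5) by (intro bexp_mono) (auto intro!: monoD[OF insert.prems(1)])
  have e01: "?e0 \<in> {0..1}" "?e1 \<in> {0..1}"
    using insert.prems(2) insert.hyps assms by (auto intro!: bexp_bounds simp del: atLeastAtMost_iff)
  have "(?e1 - ?e0)\<^sup>2 \<le> ?e1 - ?e0"
    using e e01 mult_left_le[of "?e1 - ?e0" "?e1 - ?e0"] by (auto simp: power2_eq_square)
  then have step: "p * (1 - p) * (?e1 - ?e0)\<^sup>2 \<le> ?e1 - ?e0"
    using mult_mono[of "p * (1 - p)" 1 "(?e1 - ?e0)\<^sup>2" "?e1 - ?e0"] assms(4,5)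
      mult_le_one[of p "1 - p"] by auto
  have "bexp (insert a S) p (\<lambda>E. (g E)\<^sup>2) - (bexp (insert a S) p g)\<^sup>2
     = p * (bexp S p (\<lambda>E. (?g E)\<^sup>2) - ?e1\<^sup>2) + (1 - p) * (bexp S p (\<lambda>E. (g E)\<^sup>2) - ?e0\<^sup>2)
       + p * (1 - p) * (?e1 - ?e0)\<^sup>2"
    using insert.hyps by (simp add: bexp_insert) (simp add: power2_eq_square algebra_simps)
  also have "\<dots> \<le> p * (\<Sum>i\<in>S. bexp S p (discrete_deriv i ?g))
       + (1 - p) * (\<Sum>i\<in>S. bexp S p (discrete_deriv i g)) + (?e1 - ?e0)"
    using insert.IH[OF mono] insert.IH[OF insert.prems] insert.prems assms(4,5) step
    by (intro add_mono mult_left_mono) auto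
  also have "\<dots> = (\<Sum>i\<in>insert a S. bexp (insert a S) p (discrete_deriv i g))"
    using insert by (auto simp: bexp_insert_deriv_self bexp_insert_deriv_other sum.distrib sum_distrib_left intro!: sum.cong)
  finally show ?case .
qed simp

text \<open>Law of total variance, conditioning on the coordinates in \<open>S\<close>.\<close>

lemma bexp_variance_split:
  assumes V: "finite V" "S \<subseteq> V" and f: "mono f" "\<And>E. f E \<in> {0, 1}"
    and g: "\<And>E. g E \<in> {0, 1}" "\<And>E. E \<subseteq> V \<Longrightarrow> f E \<le> g (E \<inter> S)" and p: "0 \<le> p" "p \<le> 1"
  shows "bexp V p f * (1 - bexp V p f) \<le>
    (bexp S p g - bexp V p f) + (\<Sum>i\<in>S. bexp V p (discrete_deriv i f))"
proof -
  define T where "T = V - S"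
  have fin: "finite S" "finite T" using V finite_subset by (auto simp: T_def)
  have split: "bexp V p k = bexp S p (\<lambda>A. bexp T p (\<lambda>B. k (A \<union> B)))" for k
    using bexp_Un[of S T p k] fin V by (auto simp: T_def Un_absorb1)
  \<comment> \<open>The conditional expectation of \<open>f\<close> given that the erasures in
    \<open>S\<close> are \<open>A\<close>.\<close>
  define u where "u = (\<lambda>A. bexp T p (\<lambda>B. f (A \<union> B)))"
  have f01: "f E \<in> {0..1}" for E using f(2)[of E] by auto
  have u01: "u A \<in> {0..1}" for A
    unfolding u_def using fin p f01 by (intro bexp_bounds) auto
  have umono: "mono u" unfolding u_def
    using f(1) p by (intro monoI bexp_mono) (auto elim!: monoD)
  have Eu: "bexp V p f = bexp S p u" by (simp add: split u_def)
  \<comment> \<open>Since \<open>f\<close> is 0/1-valued, the left side is the conditional variance.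
    If \<open>g A = 0\<close> then \<open>f\<close> vanishes throughout, and so does
    \<open>u A\<close>; if \<open>g A = 1\<close> the claim is
    \<open>u (1 - u) \<le> 1 - u\<close>.\<close>
  have "u A - (u A)\<^sup>2 \<le> g A - u A" if "A \<subseteq> S" for A
  proof (cases "g A = 0")
    case True
    have "f (A \<union> B) = 0" if "B \<subseteq> T" for B
    proof -
      have "(A \<union> B) \<inter> S = A" "A \<union> B \<subseteq> V" using that \<open>A \<subseteq> S\<close> V by (auto simp: T_def)
      then show ?thesis using g(2)[of "A \<union> B"] True f(2)[of "A \<union> B"] by auto
    qed
    then have "u A = bexp T p (\<lambda>_. 0)" unfolding u_def by (intro bexp_cong) auto
    then show ?thesis using True fin by (simp add: bexp_const)
  next
    case False
    then have "g A = 1" using g(1)[of A] by auto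
    then show ?thesis using u01[of A] zero_le_power2[of "1 - u A"]
      by (simp add: power2_eq_square algebra_simps)
  qed
  then have 1: "bexp S p u - bexp S p (\<lambda>A. (u A)\<^sup>2) \<le> bexp S p g - bexp S p u"
    using bexp_mono[OF p, of S "\<lambda>A. u A - (u A)\<^sup>2" "\<lambda>A. g A - u A"] by (simp add: bexp_diff)
  \<comment> \<open>For \<open>i\<close> in \<open>S\<close> the discrete derivative commutes with
    averaging over \<open>T\<close>, so \<open>u\<close> has the same influences as
    \<open>f\<close>.\<close>
  have 2: "bexp S p (discrete_deriv i u) = bexp V p (discrete_deriv i f)" if "i \<in> S" for i
  proof -
    have "discrete_deriv i u A = bexp T p (\<lambda>B. discrete_deriv i f (A \<union> B))" for A
      unfolding discrete_deriv_def u_def bexp_diff using that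
      by (intro arg_cong2[where f = "(-)"] bexp_cong arg_cong[where f = f]) (auto simp: T_def)
    then show ?thesis unfolding split by (intro bexp_cong)
  qed
  have "bexp S p (\<lambda>A. (u A)\<^sup>2) - (bexp S p u)\<^sup>2 \<le> (\<Sum>i\<in>S. bexp V p (discrete_deriv i f))"
    using bexp_variance_le[OF fin(1) umono u01 p] by (simp add: 2)
  then show ?thesis using 1 by (simp add: Eu power2_eq_square algebra_simps)
qed

section \<open>EXIT functions of linear codes\<close>

definition linear_code :: "'i set \<Rightarrow> ('i \<Rightarrow> bool) set \<Rightarrow> bool" where
  "linear_code I C \<longleftrightarrow> finite I \<and> (\<lambda>_. False) \<in> C \<and>
     (\<forall>c\<in>C. \<forall>d\<in>C. (\<lambda>x. c x \<noteq> d x) \<in> C) \<and> (\<forall>c\<in>C. Collect c \<subseteq> I)"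

text \<open>By linearity, bit \<open>i\<close> is not determined by the unerased positions other than \<open>i\<close> iff some
  codeword that is nonzero at \<open>i\<close> is supported on \<open>i\<close> and the erased positions \<open>E\<close>.\<close>

definition exit_ind :: "('i \<Rightarrow> bool) set \<Rightarrow> 'i \<Rightarrow> 'i set \<Rightarrow> real" where
  "exit_ind C i E = of_bool (\<exists>c\<in>C. c i \<and> Collect c \<subseteq> insert i E)"

lemma exit_ind_01: "exit_ind C i E \<in> {0, 1}"
  by (auto simp: exit_ind_def)

lemma mono_exit_ind: "mono (exit_ind C i)"
  unfolding exit_ind_def by (intro monoI) (auto simp: of_bool_def)

lemma discrete_deriv_exit_ind_self: "discrete_deriv i (exit_ind C i) E = 0"
  by (simp add: discrete_deriv_def exit_ind_def)

lemma finite_linear_code: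
  assumes "linear_code I C"
  shows "finite C"
proof (rule finite_imageD[of Collect])
  have "Collect ` C \<subseteq> Pow I" "finite I" using assms by (auto simp: linear_code_def)
  then show "finite (Collect ` C)" by (meson finite_Pow_iff finite_subset)
qed (auto simp: inj_on_def set_eq_iff)

text \<open>The logarithm is the dimension of the subcode supported on \<open>E\<close>. Admitting
  \<open>i\<close> into the support either adds no codeword or doubles the subcode: the words
  nonzero at \<open>i\<close> form a coset of those vanishing there, via addition of one such word
  \<open>c0\<close>.\<close>

lemma discrete_deriv_log_card:
  assumes "linear_code I C"
  shows "discrete_deriv i (\<lambda>E. log 2 (real (card {c \<in> C. Collect c \<subseteq> E}))) E = exit_ind C i E"
proof -
  define A where "A = {c \<in> C. Collect c \<subseteq> E - {i}}"
  define B where "B = {c \<in> C. Collect c \<subseteq> insert i E}"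
  have fin: "finite A" "finite B" using finite_linear_code[OF assms] by (auto simp: A_def B_def)
  have AB: "A = {c \<in> B. \<not> c i}" by (auto simp: A_def B_def)
  have "(\<lambda>_. False) \<in> A" using assms by (auto simp: A_def linear_code_def)
  then have A0: "card A > 0" using fin by (auto simp: card_gt_0_iff)
  have "log 2 (card B) - log 2 (card A) = exit_ind C i E"
  proof (cases "\<exists>c\<in>B. c i")
    case False
    then have "A = B" using AB by auto
    moreover have "exit_ind C i E = 0" using False by (auto simp: exit_ind_def B_def)
    ultimately show ?thesis by simp
  next
    case True
    then obtain c0 where c0: "c0 \<in> B" "c0 i" by auto
    define t where "t = (\<lambda>c x. c x \<noteq> c0 x)"
    have tt: "t (t c) = c" for c by (auto simp: t_def)
    have tB: "t c \<in> B" if "c \<in> B" for c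
      using that c0 assms by (auto simp: t_def B_def linear_code_def)
    have "t ` A = {c \<in> B. c i}"
    proof
      show "t ` A \<subseteq> {c \<in> B. c i}" using tB c0 by (auto simp: AB t_def)
      show "{c \<in> B. c i} \<subseteq> t ` A"
      proof
        fix c assume "c \<in> {c \<in> B. c i}"
        then have "t c \<in> A" using tB c0 by (auto simp: AB t_def)
        then show "c \<in> t ` A" by (metis tt imageI)
      qed
    qed
    then have "B = A \<union> t ` A" "A \<inter> t ` A = {}" by (auto simp: AB)
    then have "card B = card A + card (t ` A)" using fin by (metis card_Un_disjoint finite_Un)
    also have "card (t ` A) = card A" by (rule card_image) (intro inj_onI, metis tt)
    finally have "card B = 2 * card A" by simp
    moreover have "exit_ind C i E = 1" using True by (auto simp: exit_ind_def B_def)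
    ultimately show ?thesis using A0 by (simp add: log_mult)
  qed
  then show ?thesis by (simp add: discrete_deriv_def A_def B_def)
qed

text \<open>The area theorem: the derivative of the expected dimension of the space of codewords
  supported on the erased positions is the sum of the EXIT functions.\<close>

lemma exit_area:
  assumes "linear_code I C"
  shows "((\<lambda>p. \<Sum>i\<in>I. bexp I p (exit_ind C i)) has_integral log 2 (real (card C))) {0..1}"
proof -
  have "finite I" using assms by (simp add: linear_code_def)
  moreover have "{c \<in> C. Collect c \<subseteq> I} = C" "{c \<in> C. Collect c \<subseteq> {}} = {\<lambda>_. False}"
    using assms by (auto simp: linear_code_def)
  moreover have "discrete_deriv i (\<lambda>E. log 2 (real (card {c \<in> C. Collect c \<subseteq> E}))) = exit_ind C i" for i
    using discrete_deriv_log_card[OF assms] by auto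
  ultimately show ?thesis
    using bexp_has_integral_deriv[of I "\<lambda>E. log 2 (real (card {c \<in> C. Collect c \<subseteq> E}))"] by simp
qed

text \<open>If two codewords agree off \<open>E\<close> and differ at \<open>i\<close>, their sum is
  a codeword nonzero at \<open>i\<close> and supported on \<open>E\<close>. Hence one ambiguous
  \<open>X\<close> already forces \<open>exit_ind\<close> to be 1. Only an inequality results, as
  \<open>exit_ind\<close> treats bit \<open>i\<close> as erased in any case.\<close>

lemma bit_MAP_Pb_le_exit:
  assumes C: "linear_code I C" and p: "0 \<le> p" "p \<le> 1"
  shows "bit_MAP_Pb I C p \<le> (\<Sum>i\<in>I. bexp I p (exit_ind C i)) / real (card I)"
proof -
  have "(1 / real (card C)) * real (card {X\<in>C. \<exists>c\<in>C. (\<forall>j\<in>I - E. c j = X j) \<and> c i \<noteq> X i})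
      \<le> exit_ind C i E" if "i \<in> I" for i E
  proof (cases "\<exists>X\<in>C. \<exists>c\<in>C. (\<forall>j\<in>I - E. c j = X j) \<and> c i \<noteq> X i")
    case True
    then obtain X c where "X \<in> C" "c \<in> C" "\<forall>j\<in>I - E. c j = X j" "c i \<noteq> X i" by blast
    moreover from this have "(\<lambda>x. c x \<noteq> X x) \<in> C" "Collect c \<subseteq> I" "Collect X \<subseteq> I"
      using C by (auto simp: linear_code_def)
    ultimately have "exit_ind C i E = 1"
      unfolding exit_ind_def by (auto intro!: bexI[of _ "\<lambda>x. c x \<noteq> X x"])
    then show ?thesis using finite_linear_code[OF C] by (auto simp: divide_le_eq intro!: card_mono)
  next
    case False
    then have empty: "{X\<in>C. \<exists>c\<in>C. (\<forall>j\<in>I - E. c j = X j) \<and> c i \<noteq> X i} = {}" by blast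
    show ?thesis unfolding empty using exit_ind_01[of C i E] by auto
  qed
  then have "(\<Sum>i\<in>I. \<Sum>E\<in>Pow I. p ^ card E * (1 - p) ^ (card I - card E) *
        ((1 / real (card C)) *
          real (card {X\<in>C. \<exists>c\<in>C. (\<forall>j\<in>I - E. c j = X j) \<and> c i \<noteq> X i})))
     \<le> (\<Sum>i\<in>I. bexp I p (exit_ind C i))"
    unfolding bexp_def using p by (intro sum_mono mult_left_mono) auto
  then show ?thesis unfolding bit_MAP_Pb_def by (simp add: divide_right_mono)
qed

text \<open>Translations and transvections over the two-element field are self-inverse; demanding
  this of a symmetry yields bijectivity and the reverse inclusions at once.\<close>

definition code_involution :: "'i set \<Rightarrow> ('i \<Rightarrow> bool) set \<Rightarrow> ('i \<Rightarrow> 'i) \<Rightarrow> bool" where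
  "code_involution I C \<phi> \<longleftrightarrow> (\<forall>x. \<phi> (\<phi> x) = x) \<and> \<phi> ` I \<subseteq> I \<and> (\<forall>c\<in>C. (\<lambda>x. c (\<phi> x)) \<in> C)"

lemma exit_ind_involution:
  assumes "code_involution I C \<phi>"
  shows "exit_ind C (\<phi> i) (\<phi> ` E) = exit_ind C i E"
proof -
  have inv: "\<phi> (\<phi> x) = x" for x using assms by (simp add: code_involution_def)
  have imp: "\<exists>c\<in>C. c (\<phi> i) \<and> Collect c \<subseteq> insert (\<phi> i) (\<phi> ` E)"
    if "\<exists>c\<in>C. c i \<and> Collect c \<subseteq> insert i E" for i E
  proof -
    obtain c where c: "c \<in> C" "c i" "Collect c \<subseteq> insert i E" using \<open>\<exists>c\<in>C. _ c\<close> by auto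
    have "Collect (\<lambda>x. c (\<phi> x)) \<subseteq> insert (\<phi> i) (\<phi> ` E)"
    proof
      fix x assume "x \<in> Collect (\<lambda>x. c (\<phi> x))"
      then have "\<phi> x \<in> insert i E" using c by auto
      then have "\<phi> (\<phi> x) \<in> insert (\<phi> i) (\<phi> ` E)" by auto
      then show "x \<in> insert (\<phi> i) (\<phi> ` E)" by (simp add: inv)
    qed
    then show ?thesis using c assms inv
      by (intro bexI[of _ "\<lambda>x. c (\<phi> x)"]) (auto simp: code_involution_def)
  qed
  have "\<phi> ` \<phi> ` E = E" by (simp add: image_image inv)
  then have "(\<exists>c\<in>C. c (\<phi> i) \<and> Collect c \<subseteq> insert (\<phi> i) (\<phi> ` E)) \<longleftrightarrow>
      (\<exists>c\<in>C. c i \<and> Collect c \<subseteq> insert i E)"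
    using imp[of i E] imp[of "\<phi> i" "\<phi> ` E"] by (intro iffI) (simp_all only: inv)
  then show ?thesis by (simp only: exit_ind_def)
qed

lemma code_involution_bij: "code_involution I C \<phi> \<Longrightarrow> bij_betw \<phi> I I"
  by (rule bij_betwI[of _ _ _ \<phi>]) (auto simp: code_involution_def)

lemma bexp_exit_involution:
  assumes "code_involution I C \<phi>"
  shows "bexp I p (exit_ind C (\<phi> i)) = bexp I p (exit_ind C i)"
  using bexp_reindex[OF code_involution_bij[OF assms], of p "exit_ind C (\<phi> i)"]
  by (simp add: exit_ind_involution[OF assms])

text \<open>A symmetry fixing \<open>z\<close> leaves \<open>exit_ind C z\<close> invariant, so it
  carries the event that \<open>i\<close> is pivotal to the event that its image is.\<close>

lemma influence_involution:
  assumes "code_involution I C \<phi>" "\<phi> z = z"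
  shows "bexp I p (discrete_deriv (\<phi> i) (exit_ind C z)) = bexp I p (discrete_deriv i (exit_ind C z))"
proof -
  have inv: "\<phi> (\<phi> x) = x" for x using assms by (simp add: code_involution_def)
  have F: "exit_ind C z (\<phi> ` E) = exit_ind C z E" for E
    using exit_ind_involution[OF assms(1), of z E] assms(2) by simp
  have "insert (\<phi> i) (\<phi> ` E) = \<phi> ` insert i E" "\<phi> ` E - {\<phi> i} = \<phi> ` (E - {i})" for E
    using image_set_diff[OF injI[of \<phi>], of E "{i}"] by (simp, metis inv image_insert image_empty)
  then have "discrete_deriv (\<phi> i) (exit_ind C z) (\<phi> ` E) = discrete_deriv i (exit_ind C z) E" for E
    unfolding discrete_deriv_def by (simp only: F)
  then show ?thesis
    using bexp_reindex[OF code_involution_bij[OF assms(1)], of p "discrete_deriv (\<phi> i) (exit_ind C z)"]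
    by simp
qed

section \<open>Reed--Muller codes\<close>

definition RM_word :: "nat \<Rightarrow> nat set set \<Rightarrow> nat set \<Rightarrow> bool" where
  "RM_word m A = (\<lambda>x. x \<subseteq> {..<m} \<and> odd (card {T\<in>A. T \<subseteq> x}))"

lemma RM_code_eq: "RM_code v m = RM_word m ` Pow (RM_monomials v m)"
  by (auto simp: RM_code_def RM_word_def)

lemma finite_RM_monomials: "finite (RM_monomials v m)"
  by (rule finite_subset[of _ "Pow {..<m}"]) (auto simp: RM_monomials_def)

lemma finite_RM_coords [simp]: "finite (RM_coords m)"
  by (simp add: RM_coords_def)

lemma odd_card_sym_diff:
  assumes "finite A" "finite B"
  shows "odd (card (sym_diff A B)) \<longleftrightarrow> odd (card A) \<noteq> odd (card B)"
proof -
  have "card A = card (A - B) + card (A \<inter> B)" "card B = card (B - A) + card (A \<inter> B)"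
    using assms by (metis Int_commute add.commute card_Diff_subset_Int card_Int_Diff)+
  moreover have "card (sym_diff A B) = card (A - B) + card (B - A)"
    using assms by (intro card_Un_disjoint) auto
  ultimately show ?thesis by auto
qed

lemma RM_word_sym_diff:
  assumes "finite A" "finite B"
  shows "RM_word m (sym_diff A B) = (\<lambda>x. RM_word m A x \<noteq> RM_word m B x)"
proof
  fix x
  have "{T\<in>sym_diff A B. T \<subseteq> x} = sym_diff {T\<in>A. T \<subseteq> x} {T\<in>B. T \<subseteq> x}" by auto
  then show "RM_word m (sym_diff A B) x = (RM_word m A x \<noteq> RM_word m B x)"
    using odd_card_sym_diff[of "{T\<in>A. T \<subseteq> x}" "{T\<in>B. T \<subseteq> x}"] assms
    by (auto simp: RM_word_def)
qed

lemma RM_word_monomial: "RM_word m {T} = (\<lambda>x. x \<subseteq> {..<m} \<and> T \<subseteq> x)"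
proof
  fix x
  have "{S\<in>{T}. S \<subseteq> x} = (if T \<subseteq> x then {T} else {})" by auto
  then show "RM_word m {T} x = (x \<subseteq> {..<m} \<and> T \<subseteq> x)" by (simp add: RM_word_def)
qed

lemma RM_code_zero: "(\<lambda>_. False) \<in> RM_code v m"
  unfolding RM_code_eq by (rule image_eqI[of _ _ "{}"]) (auto simp: RM_word_def)

lemma RM_code_xor:
  assumes "c \<in> RM_code v m" "d \<in> RM_code v m"
  shows "(\<lambda>x. c x \<noteq> d x) \<in> RM_code v m"
proof -
  obtain A B where AB: "A \<subseteq> RM_monomials v m" "B \<subseteq> RM_monomials v m" "c = RM_word m A" "d = RM_word m B"
    using assms by (auto simp: RM_code_eq)
  then have "finite A" "finite B" using finite_RM_monomials finite_subset by blast+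
  then have "(\<lambda>x. c x \<noteq> d x) = RM_word m (sym_diff A B)" using AB by (simp add: RM_word_sym_diff)
  then show ?thesis using AB by (auto simp: RM_code_eq)
qed

lemma RM_code_monomial:
  assumes "T \<subseteq> {..<m}" "card T \<le> v"
  shows "(\<lambda>x. x \<subseteq> {..<m} \<and> T \<subseteq> x) \<in> RM_code v m"
  unfolding RM_code_eq RM_word_monomial[symmetric] using assms by (auto simp: RM_monomials_def)

lemma linear_RM_code: "linear_code (RM_coords m) (RM_code v m)"
  using RM_code_zero RM_code_xor
  by (auto simp: linear_code_def RM_coords_def RM_code_eq RM_word_def)

text \<open>Codewords are sums of monomials, so statements closed under addition need checking on
  monomials only.\<close>

lemma RM_code_induct [consumes 1, case_names zero monomial xor]:
  assumes "c \<in> RM_code v m"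
    and zero: "P (\<lambda>_. False)"
    and monomial: "\<And>T. T \<subseteq> {..<m} \<Longrightarrow> card T \<le> v \<Longrightarrow> P (\<lambda>x. x \<subseteq> {..<m} \<and> T \<subseteq> x)"
    and xor: "\<And>c d. P c \<Longrightarrow> P d \<Longrightarrow> P (\<lambda>x. c x \<noteq> d x)"
  shows "P c"
proof -
  obtain A where A: "A \<subseteq> RM_monomials v m" "c = RM_word m A" using assms(1) by (auto simp: RM_code_eq)
  have "finite A" using A finite_RM_monomials finite_subset by blast
  then have "P (RM_word m A)" using A(1)
  proof (induction A rule: finite_induct)
    case empty
    then show ?case using zero by (simp add: RM_word_def)
  next
    case (insert T A)
    have "sym_diff {T} A = insert T A" using insert by auto
    then have "RM_word m (insert T A) = (\<lambda>x. RM_word m {T} x \<noteq> RM_word m A x)"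
      using RM_word_sym_diff[of "{T}" A m] insert by simp
    moreover have "P (RM_word m {T})"
      unfolding RM_word_monomial using insert by (intro monomial) (auto simp: RM_monomials_def)
    ultimately show ?case using insert xor by simp
  qed
  then show ?thesis using A by simp
qed

lemma RM_code_mono: "v \<le> w \<Longrightarrow> RM_code v m \<subseteq> RM_code w m"
  by (auto simp: RM_code_eq RM_monomials_def intro!: imageI)

text \<open>By bilinearity it suffices to multiply monomials, and the product of those of
  \<open>T\<close> and \<open>U\<close> is that of \<open>T \<union> U\<close> because coordinates
  are idempotent.\<close>

lemma RM_code_mult:
  assumes "c \<in> RM_code v m" "d \<in> RM_code w m"
  shows "(\<lambda>x. c x \<and> d x) \<in> RM_code (v + w) m"
  using assms(1)
proof (induction rule: RM_code_induct)
  case (monomial T)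
  show ?case using assms(2)
  proof (induction rule: RM_code_induct)
    case (monomial U)
    have "(\<lambda>x. (x \<subseteq> {..<m} \<and> T \<subseteq> x) \<and> x \<subseteq> {..<m} \<and> U \<subseteq> x) = (\<lambda>x. x \<subseteq> {..<m} \<and> T \<union> U \<subseteq> x)"
      by auto
    moreover have "card (T \<union> U) \<le> v + w"
      using card_Un_le[of T U] monomial \<open>card T \<le> v\<close> by linarith
    ultimately show ?case using RM_code_monomial[of "T \<union> U" m "v + w"] monomial \<open>T \<subseteq> _\<close> by simp
  next
    case (xor c d)
    have "(\<lambda>x. (x \<subseteq> {..<m} \<and> T \<subseteq> x) \<and> c x \<noteq> d x) =
      (\<lambda>x. ((x \<subseteq> {..<m} \<and> T \<subseteq> x) \<and> c x) \<noteq> ((x \<subseteq> {..<m} \<and> T \<subseteq> x) \<and> d x))" by auto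
    then show ?case using RM_code_xor[OF xor] by simp
  qed (simp add: RM_code_zero)
next
  case (xor a b)
  have "(\<lambda>x. a x \<noteq> b x \<and> d x) = (\<lambda>x. (a x \<and> d x) \<noteq> (b x \<and> d x))" by auto
  then show ?case using RM_code_xor[OF xor] by simp
qed (simp add: RM_code_zero)

text \<open>Substituting affine forms for the variables turns a monomial into a product of
  \<open>card T\<close> polynomials of degree at most 1, so \<open>RM_code_mult\<close> keeps the
  degree bound.\<close>

lemma RM_code_subst:
  assumes \<phi>: "\<And>x. \<phi> x \<subseteq> {..<m} \<longleftrightarrow> x \<subseteq> {..<m}"
    and aff: "\<And>i. i < m \<Longrightarrow> (\<lambda>x. x \<subseteq> {..<m} \<and> i \<in> \<phi> x) \<in> RM_code 1 m"
    and c: "c \<in> RM_code v m"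
  shows "(\<lambda>x. c (\<phi> x)) \<in> RM_code v m"
  using c
proof (induction rule: RM_code_induct)
  case (monomial T)
  have "finite T" using monomial finite_subset by blast
  then have "T \<subseteq> {..<m} \<Longrightarrow> (\<lambda>x. x \<subseteq> {..<m} \<and> T \<subseteq> \<phi> x) \<in> RM_code (card T) m"
  proof (induction T rule: finite_induct)
    case empty
    then show ?case using RM_code_monomial[of "{}" m 0] by simp
  next
    case (insert i T)
    then have "(\<lambda>x. (x \<subseteq> {..<m} \<and> i \<in> \<phi> x) \<and> (x \<subseteq> {..<m} \<and> T \<subseteq> \<phi> x)) \<in> RM_code (1 + card T) m"
      by (intro RM_code_mult aff) auto
    moreover have "(\<lambda>x. (x \<subseteq> {..<m} \<and> i \<in> \<phi> x) \<and> (x \<subseteq> {..<m} \<and> T \<subseteq> \<phi> x)) =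
      (\<lambda>x. x \<subseteq> {..<m} \<and> insert i T \<subseteq> \<phi> x)" by auto
    ultimately show ?case using insert by simp
  qed
  then show ?case using monomial RM_code_mono[of "card T" v m] by (auto simp: \<phi>)
next
  case (xor c d)
  then show ?case by (rule RM_code_xor)
qed (rule RM_code_zero)

text \<open>Translations are the case \<open>l = True\<close>; transvections the case of a linear form \<open>l\<close>
  vanishing at \<open>u\<close>.\<close>

lemma RM_code_involution:
  assumes u: "u \<subseteq> {..<m}" and l: "(\<lambda>x. x \<subseteq> {..<m} \<and> l x) \<in> RM_code 1 m"
    and inv: "\<And>x. l (sym_diff x u) = l x"
  shows "code_involution (RM_coords m) (RM_code v m) (\<lambda>x. if l x then sym_diff x u else x)"
proof -
  let ?\<phi> = "\<lambda>x. if l x then sym_diff x u else x"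
  have "(\<lambda>x. c (?\<phi> x)) \<in> RM_code v m" if "c \<in> RM_code v m" for c
  proof (rule RM_code_subst[OF _ _ that])
    fix i assume i: "i < m"
    have xi: "(\<lambda>x. x \<subseteq> {..<m} \<and> {i} \<subseteq> x) \<in> RM_code 1 m"
      using i by (intro RM_code_monomial) auto
    \<comment> \<open>Coordinate \<open>i\<close> of the image is the affine form x_i + u_i
      l(x).\<close>
    show "(\<lambda>x. x \<subseteq> {..<m} \<and> i \<in> ?\<phi> x) \<in> RM_code 1 m"
    proof (cases "i \<in> u")
      case True
      then have "(\<lambda>x. x \<subseteq> {..<m} \<and> i \<in> ?\<phi> x) =
          (\<lambda>x. (x \<subseteq> {..<m} \<and> {i} \<subseteq> x) \<noteq> (x \<subseteq> {..<m} \<and> l x))" by auto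
      then show ?thesis using RM_code_xor[OF xi l] by simp
    next
      case False
      then have "(\<lambda>x. x \<subseteq> {..<m} \<and> i \<in> ?\<phi> x) = (\<lambda>x. x \<subseteq> {..<m} \<and> {i} \<subseteq> x)" by auto
      then show ?thesis using xi by simp
    qed
  qed (use u in auto)
  moreover have "sym_diff (sym_diff x u) u = x" for x by auto
  ultimately show ?thesis
    using u inv by (auto simp: code_involution_def RM_coords_def split: if_splits)
qed

lemma RM_translation:
  assumes "u \<subseteq> {..<m}"
  shows "code_involution (RM_coords m) (RM_code v m) (\<lambda>x. sym_diff x u)"
  using RM_code_involution[OF assms, of "\<lambda>_. True" v] RM_code_monomial[of "{}" m 1] by simp

text \<open>Take the direction u = a + b and a linear form \<open>l\<close> with l(a) = l(b) = 1.
  Then l(u) = 0, the origin is fixed, and \<open>a\<close> moves to a + u = b.\<close>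

lemma RM_transvection:
  assumes ab: "a \<subseteq> {..<m}" "b \<subseteq> {..<m}" "a \<noteq> {}" "b \<noteq> {}"
  obtains \<phi> where "code_involution (RM_coords m) (RM_code v m) \<phi>" "\<phi> {} = {}" "\<phi> a = b"
proof -
  have lin: "(\<lambda>x. x \<subseteq> {..<m} \<and> i \<in> x) \<in> RM_code 1 m" if "i < m" for i
    using RM_code_monomial[of "{i}" m 1] that by simp
  \<comment> \<open>If \<open>a\<close> and \<open>b\<close> share a coordinate, that coordinate
    serves as \<open>l\<close>; otherwise the sum of one coordinate from each does.\<close>
  have "\<exists>l. (\<lambda>x. x \<subseteq> {..<m} \<and> l x) \<in> RM_code 1 m \<and> (\<forall>x. l (sym_diff x (sym_diff a b)) = l x)
      \<and> l a \<and> \<not> l {}"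
  proof (cases "a \<inter> b = {}")
    case False
    then obtain i where "i \<in> a" "i \<in> b" by auto
    then show ?thesis using ab lin[of i] by (intro exI[of _ "\<lambda>x. i \<in> x"]) auto
  next
    case True
    obtain i j where ij: "i \<in> a" "j \<in> b" using ab by auto
    then have "i \<notin> b" "j \<notin> a" "i < m" "j < m" using True ab by auto
    moreover have "(\<lambda>x. x \<subseteq> {..<m} \<and> (i \<in> x) \<noteq> (j \<in> x)) =
      (\<lambda>x. (x \<subseteq> {..<m} \<and> i \<in> x) \<noteq> (x \<subseteq> {..<m} \<and> j \<in> x))" by auto
    ultimately show ?thesis using ij RM_code_xor[OF lin[of i] lin[of j]]
      by (intro exI[of _ "\<lambda>x. (i \<in> x) \<noteq> (j \<in> x)"]) simp
  qed
  then obtain l where l: "(\<lambda>x. x \<subseteq> {..<m} \<and> l x) \<in> RM_code 1 m"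
    "\<And>x. l (sym_diff x (sym_diff a b)) = l x" "l a" "\<not> l {}" by blast
  have "sym_diff a (sym_diff a b) = b" by auto
  then show thesis
    using that[OF RM_code_involution[of "sym_diff a b" m l v]] l ab by auto
qed

text \<open>Setting the coordinates from \<open>n\<close> on to 0 kills the monomials that involve
  them and leaves the others unchanged.\<close>

lemma RM_code_restrict:
  assumes "c \<in> RM_code v m" "n \<le> m"
  shows "(\<lambda>x. x \<subseteq> {..<n} \<and> c x) \<in> RM_code v n"
  using assms(1)
proof (induction rule: RM_code_induct)
  case (monomial T)
  show ?case
  proof (cases "T \<subseteq> {..<n}")
    case True
    have "(\<lambda>x. x \<subseteq> {..<n} \<and> x \<subseteq> {..<m} \<and> T \<subseteq> x) = (\<lambda>x. x \<subseteq> {..<n} \<and> T \<subseteq> x)"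
      using assms(2) by fastforce
    then show ?thesis using RM_code_monomial[OF True monomial(2)] by simp
  next
    case False
    then have "(\<lambda>x. x \<subseteq> {..<n} \<and> x \<subseteq> {..<m} \<and> T \<subseteq> x) = (\<lambda>_. False)" by auto
    then show ?thesis using RM_code_zero by simp
  qed
next
  case (xor c d)
  have "(\<lambda>x. x \<subseteq> {..<n} \<and> c x \<noteq> d x) = (\<lambda>x. (x \<subseteq> {..<n} \<and> c x) \<noteq> (x \<subseteq> {..<n} \<and> d x))" by auto
  then show ?case using RM_code_xor[OF xor] by simp
qed (simp add: RM_code_zero)

text \<open>Evaluate the difference of the two polynomials at the point \<open>T\<close>, where
  \<open>T\<close> is a monomial of least degree in it. Any other monomial nonzero there would be a
  proper subset of \<open>T\<close>, so the value is 1.\<close>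

lemma inj_on_RM_word: "inj_on (RM_word m) (Pow (RM_monomials v m))"
proof (rule inj_onI)
  fix A B assume AB: "A \<in> Pow (RM_monomials v m)" "B \<in> Pow (RM_monomials v m)"
    and eq: "RM_word m A = RM_word m B"
  have fin: "finite A" "finite B" using AB finite_RM_monomials finite_subset by blast+
  show "A = B"
  proof (rule ccontr)
    assume "A \<noteq> B"
    then have "\<exists>T. T \<in> sym_diff A B" by auto
    then obtain T where T: "T \<in> sym_diff A B" "\<And>S. S \<in> sym_diff A B \<Longrightarrow> card T \<le> card S"
      using exists_least_iff[of "\<lambda>n. \<exists>T. T \<in> sym_diff A B \<and> card T = n"] by (metis not_le)
    have Tm: "T \<subseteq> {..<m}" using T AB by (auto simp: RM_monomials_def)
    have "{S \<in> sym_diff A B. S \<subseteq> T} = {T}"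
    proof -
      have "S = T" if "S \<in> sym_diff A B" "S \<subseteq> T" for S
        using T(2)[OF that(1)] that(2) Tm by (meson card_seteq finite_lessThan finite_subset)
      then show ?thesis using T(1) by blast
    qed
    then have "RM_word m (sym_diff A B) T" using Tm by (simp add: RM_word_def)
    then show False using fin eq by (simp add: RM_word_sym_diff)
  qed
qed

lemma card_RM_monomials: "card (RM_monomials v m) = (\<Sum>k=0..v. m choose k)"
proof -
  have "RM_monomials v m = (\<Union>k\<in>{0..v}. {T. T \<subseteq> {..<m} \<and> card T = k})"
    by (auto simp: RM_monomials_def)
  also have "card \<dots> = (\<Sum>k=0..v. card {T. T \<subseteq> {..<m} \<and> card T = k})"
    by (intro card_UN_disjoint) (auto intro: finite_subset[of _ "Pow {..<m}"])
  finally show ?thesis by (simp add: n_subsets)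
qed

lemma log_card_RM_code: "log 2 (real (card (RM_code v m))) = 2 ^ m * RM_rate v m"
proof -
  have "card (RM_code v m) = 2 ^ (\<Sum>k=0..v. m choose k)"
    unfolding RM_code_eq
    by (simp add: card_image inj_on_RM_word card_Pow finite_RM_monomials card_RM_monomials)
  then show ?thesis by (simp add: RM_rate_def log_nat_power)
qed

section \<open>The EXIT function of Reed--Muller codes\<close>

definition RM_exit :: "nat \<Rightarrow> nat \<Rightarrow> real \<Rightarrow> real" where
  "RM_exit v m p = bexp (RM_coords m) p (exit_ind (RM_code v m) {})"

text \<open>Translations carry the origin to every point, so all bits share one EXIT
  function.\<close>

lemma sum_exit_RM:
  "(\<Sum>i\<in>RM_coords m. bexp (RM_coords m) p (exit_ind (RM_code v m) i)) = 2 ^ m * RM_exit v m p"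
proof -
  have "bexp (RM_coords m) p (exit_ind (RM_code v m) i) = RM_exit v m p" if "i \<in> RM_coords m" for i
    using bexp_exit_involution[OF RM_translation[of i m v], of p "{}"] that
    by (simp add: RM_exit_def RM_coords_def)
  then show ?thesis by (simp add: RM_coords_def card_Pow)
qed

lemma RM_exit_has_integral: "(RM_exit v m has_integral RM_rate v m) {0..1}"
proof -
  have "((\<lambda>p. 2 ^ m * RM_exit v m p) has_integral (2 ^ m * RM_rate v m)) {0..1}"
    using exit_area[OF linear_RM_code, of m v] by (simp add: sum_exit_RM log_card_RM_code)
  from has_integral_mult_right[OF this, of "1 / 2 ^ m"] show ?thesis by simp
qed

lemma bit_MAP_Pb_le_RM_exit:
  assumes "0 \<le> p" "p \<le> 1"
  shows "bit_MAP_Pb (RM_coords m) (RM_code v m) p \<le> RM_exit v m p"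
  using bit_MAP_Pb_le_exit[OF linear_RM_code assms, of m v]
  by (simp add: sum_exit_RM) (simp add: RM_coords_def card_Pow)

lemma RM_exit_bounds: "0 \<le> p \<Longrightarrow> p \<le> 1 \<Longrightarrow> RM_exit v m p \<in> {0..1}"
  unfolding RM_exit_def using exit_ind_01[of "RM_code v m" "{}"]
  by (intro bexp_bounds) (auto, metis order_refl zero_le_one, metis order_refl zero_le_one)

text \<open>The origin has influence 0, and by transvections all other points have a common
  influence \<open>t\<close>. The sums are thus \<open>(2 ^ n - 1) * t\<close> and
  \<open>(2 ^ m - 1) * t\<close>.\<close>

lemma RM_influences_sum_le:
  fixes v :: nat
  assumes "n \<le> m" and p: "0 \<le> p" "p \<le> 1"
  defines "J \<equiv> \<lambda>i. bexp (RM_coords m) p (discrete_deriv i (exit_ind (RM_code v m) {}))"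
  shows "(\<Sum>i\<in>RM_coords n. J i) \<le> 2 ^ n / 2 ^ m * (\<Sum>i\<in>RM_coords m. J i)"
proof -
  have J0: "J {} = 0"
    unfolding J_def by (simp add: discrete_deriv_exit_ind_self[abs_def] bexp_const)
  have Jnn: "0 \<le> J i" for i
    unfolding J_def using bexp_mono[OF p discrete_deriv_nonneg[OF mono_exit_ind], of "RM_coords m"]
    by (simp add: bexp_const)
  have eq: "J a = J b" if "a \<in> RM_coords m - {{}}" "b \<in> RM_coords m - {{}}" for a b
  proof -
    obtain \<phi> where "code_involution (RM_coords m) (RM_code v m) \<phi>" "\<phi> {} = {}" "\<phi> a = b"
      using RM_transvection[of a m b v] \<open>a \<in> _\<close> \<open>b \<in> _\<close> by (auto simp: RM_coords_def)
    then show ?thesis using influence_involution[of "RM_coords m" "RM_code v m" \<phi> "{}" p a]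
      by (simp add: J_def)
  qed
  define t where "t = J {0}"
  have t: "J a = t" if "a \<in> RM_coords m" "a \<noteq> {}" for a
    unfolding t_def using that by (intro eq) (auto simp: RM_coords_def)
  have sub: "(\<Sum>i\<in>RM_coords k. J i) = (2 ^ k - 1) * t" if "k \<le> m" for k
  proof -
    have "(\<Sum>i\<in>RM_coords k. J i) = (\<Sum>i\<in>RM_coords k - {{}}. J i)"
      by (intro sum.mono_neutral_right) (auto simp: J0)
    also have "\<dots> = (\<Sum>i\<in>RM_coords k - {{}}. t)"
      using that by (intro sum.cong t) (auto simp: RM_coords_def)
    also have "\<dots> = (2 ^ k - 1) * t" by (simp add: RM_coords_def card_Pow of_nat_diff)
    finally show ?thesis .
  qed
  \<comment> \<open>The right factor is \<open>2 ^ n / 2 ^ m\<close> times \<open>2 ^ m - 1\<close>;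
    the claim uses \<open>2 ^ n / 2 ^ m \<le> 1\<close>.\<close>
  have "(2 ^ n - 1) * t \<le> (2 ^ n - 2 ^ n / 2 ^ m) * t"
    using assms(1) Jnn[of "{0}"] by (intro mult_right_mono) (auto simp: t_def field_simps)
  then show ?thesis by (simp add: sub assms(1) field_simps)
qed

lemma RM_exit_variance_le:
  assumes "n \<le> m" and p: "0 \<le> p" "p \<le> 1"
  shows "RM_exit v m p * (1 - RM_exit v m p) \<le> (RM_exit v n p - RM_exit v m p) +
    2 ^ n / 2 ^ m * (\<Sum>i\<in>RM_coords m. bexp (RM_coords m) p (discrete_deriv i (exit_ind (RM_code v m) {})))"
proof -
  have sub: "RM_coords n \<subseteq> RM_coords m" using assms(1) by (auto simp: RM_coords_def)
  \<comment> \<open>The subcube contains the origin, so restricting a witness to it gives a witness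
    for the shorter code.\<close>
  have "exit_ind (RM_code v m) {} E \<le> exit_ind (RM_code v n) {} (E \<inter> RM_coords n)" for E
  proof -
    have "\<exists>d\<in>RM_code v n. d {} \<and> Collect d \<subseteq> insert {} (E \<inter> RM_coords n)"
      if "c \<in> RM_code v m" "c {}" "Collect c \<subseteq> insert {} E" for c
      using that RM_code_restrict[OF that(1) assms(1)]
      by (intro bexI[of _ "\<lambda>x. x \<subseteq> {..<n} \<and> c x"]) (auto simp: RM_coords_def)
    then show ?thesis by (auto simp: exit_ind_def of_bool_def)
  qed
  then have "RM_exit v m p * (1 - RM_exit v m p) \<le> (RM_exit v n p - RM_exit v m p) +
     (\<Sum>i\<in>RM_coords n. bexp (RM_coords m) p (discrete_deriv i (exit_ind (RM_code v m) {})))"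
    unfolding RM_exit_def using sub p
    by (intro bexp_variance_split mono_exit_ind exit_ind_01) auto
  then show ?thesis using RM_influences_sum_le[OF assms, of v] by linarith
qed

lemma RM_exit_sharp:
  assumes "n \<le> m" and p: "0 \<le> p" "p \<le> 1"
  shows "RM_exit v m p * (1 - p - RM_rate v m) \<le> RM_rate v n - RM_rate v m + 2 ^ n / 2 ^ m"
proof -
  let ?h = "RM_exit v m" and ?F = "exit_ind (RM_code v m) {}" and ?I = "RM_coords m"
  have hint: "?h integrable_on {a..b}" "(\<lambda>p. ?h p * (1 - ?h p)) integrable_on {a..b}" for a b
    unfolding RM_exit_def by (intro integrable_continuous_real continuous_intros continuous_on_bexp)+
  have 1: "integral {0..1} (\<lambda>p. ?h p * (1 - ?h p)) \<le> RM_rate v n - RM_rate v m + 2 ^ n / 2 ^ m * (?F ?I - ?F {})"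
  proof (rule has_integral_le[OF integrable_integral[OF hint(2)]])
    show "((\<lambda>p. (RM_exit v n p - ?h p) + 2 ^ n / 2 ^ m * (\<Sum>i\<in>?I. bexp ?I p (discrete_deriv i ?F)))
        has_integral (RM_rate v n - RM_rate v m + 2 ^ n / 2 ^ m * (?F ?I - ?F {}))) {0..1}"
      by (intro has_integral_add has_integral_diff has_integral_mult_right
          RM_exit_has_integral bexp_has_integral_deriv finite_RM_coords)
    show "?h p * (1 - ?h p) \<le> (RM_exit v n p - ?h p) + 2 ^ n / 2 ^ m * (\<Sum>i\<in>?I. bexp ?I p (discrete_deriv i ?F))"
      if "p \<in> {0..1}" for p
      using that by (intro RM_exit_variance_le assms(1)) auto
  qed
  \<comment> \<open>The integrated total influence is a difference of two 0/1 values.\<close>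
  have "2 ^ n / 2 ^ m * (?F ?I - ?F {}) \<le> 2 ^ n / 2 ^ m * (1::real)"
    using exit_ind_01[of "RM_code v m" "{}" ?I] exit_ind_01[of "RM_code v m" "{}" "{}"]
    by (intro mult_left_mono) auto
  moreover have "?h p * (1 - p - RM_rate v m) \<le> ?h p * (1 - p - integral {p..1} ?h)"
  proof -
    have "integral {p..1} ?h \<le> integral {0..1} ?h"
      using p RM_exit_bounds hint by (intro integral_subset_le) auto
    also have "\<dots> = RM_rate v m" using RM_exit_has_integral by (rule integral_unique)
    finally show ?thesis using RM_exit_bounds[OF p] by (intro mult_left_mono) auto
  qed
  moreover have "?h p * (1 - p - integral {p..1} ?h) = integral {p..1} (\<lambda>q. ?h p * (1 - ?h q))"
    using p hint integral_diff[OF integrable_continuous_real[OF continuous_on_const[of _ 1]] hint(1), of p 1]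
    by simp
  \<comment> \<open>Here monotonicity enters: \<open>?h p \<le> ?h q\<close> on
    \<open>{p..1}\<close>.\<close>
  moreover have "\<dots> \<le> integral {p..1} (\<lambda>q. ?h q * (1 - ?h q))"
  proof (intro integral_le)
    show "(\<lambda>q. ?h p * (1 - ?h q)) integrable_on {p..1}"
      unfolding RM_exit_def by (intro integrable_continuous_real continuous_intros continuous_on_bexp)
    fix q assume "q \<in> {p..1}"
    then show "?h p * (1 - ?h q) \<le> ?h q * (1 - ?h q)"
      using RM_exit_bounds[of q v m] bexp_mono_prob[OF finite_RM_coords mono_exit_ind, of p q] p
      by (intro mult_right_mono) (auto simp: RM_exit_def)
  qed (rule hint)
  moreover have "integral {p..1} (\<lambda>q. ?h q * (1 - ?h q)) \<le> integral {0..1} (\<lambda>q. ?h q * (1 - ?h q))"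
    using p RM_exit_bounds hint by (intro integral_subset_le) (auto intro!: mult_nonneg_nonneg)
  ultimately show ?thesis using 1 by linarith
qed

section \<open>Rates of Reed--Muller codes\<close>

lemma measure_std_normal_singleton: "measure std_normal_distribution {x} = 0"
proof -
  have "AE y in lborel. y \<in> {x} \<longrightarrow> ennreal (std_normal_density y) = 0"
    using AE_lborel_singleton[of x] by eventually_elim simp
  then have "{x} \<in> null_sets std_normal_distribution"
    by (subst null_sets_density_iff) auto
  then show ?thesis by (simp add: null_sets_def measure_def)
qed

lemma isCont_cdf_std_normal: "isCont (cdf std_normal_distribution) x"
proof -
  interpret N: real_distribution std_normal_distribution by (rule real_dist_normal_dist)
  show ?thesis by (simp add: N.isCont_cdf measure_std_normal_singleton)
qed

text \<open>The gauge integral in \<open>Qfun\<close> agrees with the Lebesgue integral of the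
  density, hence with the measure of \<open>{t..}\<close>. Its complement \<open>{..<t}\<close> has
  measure \<open>cdf\<close> at \<open>t\<close> because there is no atom.\<close>

lemma Qfun_eq_cdf: "Qfun t = 1 - cdf std_normal_distribution t"
proof -
  interpret N: real_distribution std_normal_distribution by (rule real_dist_normal_dist)
  have int: "set_integrable lborel {t..} std_normal_density"
    unfolding set_integrable_def by (rule integrable_mult_indicator) auto
  have "measure std_normal_distribution {t..} = integral\<^sup>L std_normal_distribution (indicator {t..})"
    by simp
  also have "\<dots> = (LINT x:{t..}|lborel. std_normal_density x)"
    unfolding set_lebesgue_integral_def
    by (subst integral_density) (auto intro!: Bochner_Integration.integral_cong)
  also have "\<dots> = integral {t..} std_normal_density"
    using int by (rule set_borel_integral_eq_integral)
  also have "\<dots> = integral {t..} (\<lambda>x. 1 / sqrt (2 * pi) * exp (-(x^2) / 2))"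
    by (intro Henstock_Kurzweil_Integration.integral_cong) (simp add: std_normal_density_def)
  also have "\<dots> = Qfun t"
    unfolding Qfun_def by (subst integral_mult_right) simp
  finally have "Qfun t = measure std_normal_distribution {t..}" by simp
  also have "\<dots> = 1 - measure std_normal_distribution {..<t}"
    using N.prob_compl[of "{..<t}"] by (simp add: Compl_eq_Diff_UNIV[symmetric] not_less)
  also have "measure std_normal_distribution {..<t} = cdf std_normal_distribution t"
    using N.finite_measure_Union[of "{..<t}" "{t}"]
    unfolding ivl_disj_un(2) by (simp add: cdf_def measure_std_normal_singleton)
  finally show ?thesis .
qed

lemma cdf_std_normal_strict_mono:
  assumes "s < t"
  shows "cdf std_normal_distribution s < cdf std_normal_distribution t"
proof (rule ccontr)
  interpret N: real_distribution std_normal_distribution by (rule real_dist_normal_dist)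
  assume "\<not> ?thesis"
  then have "measure std_normal_distribution {s<..t} = 0"
    using N.cdf_diff_eq[OF assms] N.cdf_nondecreasing[of s t] assms by simp
  then have "{s<..t} \<in> null_sets std_normal_distribution"
    by (auto simp: null_sets_def N.emeasure_eq_measure)
  then have "AE x in lborel. x \<notin> {s<..t}"
    by (subst (asm) null_sets_density_iff) (auto elim!: eventually_mono simp: std_normal_density_def)
  then have "{s<..t} \<in> null_sets lborel" by (simp add: AE_iff_null_sets)
  then show False using assms by (auto simp: null_sets_def)
qed

text \<open>The description in \<open>Qinv\<close> needs existence, from the intermediate value
  theorem, and uniqueness, from strict monotonicity.\<close>

lemma Qfun_Qinv:
  assumes "0 < y" "y < 1"
  shows "Qfun (Qinv y) = y"
proof -
  interpret N: real_distribution std_normal_distribution by (rule real_dist_normal_dist)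
  let ?F = "cdf std_normal_distribution"
  have "\<forall>\<^sub>F x in at_bot. ?F x < 1 - y" "\<forall>\<^sub>F x in at_top. ?F x > 1 - y"
    using assms by (auto intro: order_tendstoD[OF N.cdf_lim_at_bot] order_tendstoD[OF N.cdf_lim_at_top_prob])
  then obtain a b where ab: "?F a < 1 - y" "?F b > 1 - y"
    by (metis eventually_happens' trivial_limit_at_bot_linorder trivial_limit_at_top_linorder)
  then have "a \<le> b" using N.cdf_nondecreasing[of b a] by linarith
  then obtain x where x: "?F x = 1 - y"
    using IVT[of ?F a "1 - y" b] ab isCont_cdf_std_normal by (auto simp: less_imp_le)
  have "Qfun x = y" by (simp add: Qfun_eq_cdf x)
  moreover have "z = x" if "Qfun z = y" for z
    using that x cdf_std_normal_strict_mono[of x z] cdf_std_normal_strict_mono[of z x]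
    by (cases z x rule: linorder_cases) (auto simp: Qfun_eq_cdf)
  ultimately show ?thesis unfolding Qinv_def by (rule theI)
qed

section \<open>Central limit theorem for fair coin tosses\<close>

definition scaled_binomial :: "nat \<Rightarrow> real measure" where
  "scaled_binomial m = distr (measure_pmf (binomial_pmf m (1/2))) borel (\<lambda>k. (2 * real k - real m) / sqrt (real m))"

lemma real_distribution_scaled_binomial: "real_distribution (scaled_binomial m)"
  unfolding scaled_binomial_def by (rule prob_space.real_distribution_distr) (auto intro: measure_pmf.prob_space_axioms)

text \<open>With s = t / sqrt m, the binomial theorem sums the series to the m-th power of the
  average of exp(is) and exp(-is), which is cos s.\<close>

lemma char_scaled_binomial: "char (scaled_binomial m) t = complex_of_real (cos (t / sqrt (real m)) ^ m)"
proof -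
  let ?z = "iexp (t / sqrt m)" and ?w = "iexp (- (t / sqrt m))"
  have "char (scaled_binomial m) t =
     (CLINT k|measure_pmf (binomial_pmf m (1/2)). iexp (t * ((2 * real k - real m) / sqrt (real m))))"
    unfolding char_def scaled_binomial_def by (subst integral_distr) auto
  also have "\<dots> = (\<Sum>k\<le>m. pmf (binomial_pmf m (1/2)) k *\<^sub>R iexp (t * ((2 * real k - real m) / sqrt (real m))))"
    by (rule integral_measure_pmf) (auto simp: set_pmf_binomial_eq split: if_splits)
  also have "\<dots> = (\<Sum>k\<le>m. of_nat (m choose k) * (?z / 2) ^ k * (?w / 2) ^ (m - k))"
  proof (intro sum.cong refl)
    fix k assume "k \<in> {..m}"
    then have k: "k \<le> m" by simp
    have "iexp (t * ((2 * real k - real m) / sqrt (real m))) = ?z ^ k * ?w ^ (m - k)"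
      using k unfolding exp_of_nat_mult[symmetric] exp_add[symmetric]
      by (intro arg_cong[where f = exp]) (simp add: of_nat_diff field_simps diff_divide_distrib add_divide_distrib)
    moreover have "pmf (binomial_pmf m (1/2)) k = real (m choose k) * ((1/2) ^ k * (1/2) ^ (m - k))"
      by simp
    ultimately show "pmf (binomial_pmf m (1/2)) k *\<^sub>R iexp (t * ((2 * real k - real m) / sqrt (real m))) =
       of_nat (m choose k) * (?z / 2) ^ k * (?w / 2) ^ (m - k)"
      by (simp add: scaleR_conv_of_real power_divide field_simps)
  qed
  also have "\<dots> = (?z / 2 + ?w / 2) ^ m" by (rule binomial_ring[symmetric])
  also have "?z / 2 + ?w / 2 = complex_of_real (cos (t / sqrt m))"
    by (simp add: complex_eq_iff Re_exp Im_exp)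
  finally show ?thesis by simp
qed

lemma cos_power_limit: "(\<lambda>m. cos (t / sqrt (real m)) ^ m) \<longlonglongrightarrow> exp (- (t * t / 2))"
  by real_asymp

lemma weak_conv_scaled_binomial: "weak_conv_m scaled_binomial std_normal_distribution"
proof (intro levy_continuity real_distribution_scaled_binomial real_dist_normal_dist)
  fix t
  show "(\<lambda>m. char (scaled_binomial m) t) \<longlonglongrightarrow> char std_normal_distribution t"
    unfolding char_scaled_binomial char_std_normal_distribution
    using tendsto_of_real[OF cos_power_limit[of t], where 'a = complex] by (simp add: power2_eq_square)
qed

text \<open>A uniformly random subset of \<open>m\<close> elements has binomial size, so the rate is
  the probability of size at most \<open>v\<close>. Mean m/2 and standard deviation sqrt(m)/2
  convert this threshold to \<open>t\<close>.\<close>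

lemma cdf_scaled_binomial:
  assumes "m > 0" "0 \<le> real m / 2 + sqrt (real m) / 2 * t"
  shows "cdf (scaled_binomial m) t = RM_rate (nat \<lfloor>real m / 2 + sqrt (real m) / 2 * t\<rfloor>) m"
proof -
  let ?v = "nat \<lfloor>real m / 2 + sqrt (real m) / 2 * t\<rfloor>"
  have "(2 * real k - real m) / sqrt (real m) \<le> t \<longleftrightarrow> k \<le> ?v" for k
  proof -
    have "(2 * real k - real m) / sqrt (real m) \<le> t \<longleftrightarrow> real k \<le> real m / 2 + sqrt (real m) / 2 * t"
      using assms(1) by (simp add: field_simps)
    also have "\<dots> \<longleftrightarrow> k \<le> ?v" using assms(2) by (simp add: le_nat_iff le_floor_iff)
    finally show ?thesis .
  qed
  then have "cdf (scaled_binomial m) t = measure (measure_pmf (binomial_pmf m (1/2))) {..?v}"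
    unfolding cdf_def scaled_binomial_def by (subst measure_distr) (auto simp: vimage_def atMost_def)
  also have "\<dots> = (\<Sum>k=0..?v. pmf (binomial_pmf m (1/2)) k)"
    by (subst measure_measure_pmf_finite) (auto simp: atLeast0AtMost)
  also have "\<dots> = (\<Sum>k=0..?v. real (m choose k) / 2 ^ m)"
  proof (intro sum.cong refl)
    fix k
    show "pmf (binomial_pmf m (1/2)) k = real (m choose k) / 2 ^ m"
    proof (cases "k \<le> m")
      case True
      then have "(1/2::real) ^ k * (1/2) ^ (m - k) = 1 / 2 ^ m"
        by (metis le_add_diff_inverse power_add power_one_over)
      then show ?thesis by (simp add: mult.assoc)
    qed (simp add: binomial_eq_0)
  qed
  finally show ?thesis by (simp add: RM_rate_def sum_divide_distrib)
qed

text \<open>The limit law is continuous, so weak convergence gives convergence at every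
  \<open>t\<close>; the truncation at 0 is eventually inactive.\<close>

lemma RM_rate_limit:
  "(\<lambda>m. RM_rate (nat (max \<lfloor>real m / 2 + sqrt (real m) / 2 * t\<rfloor> 0)) m) \<longlonglongrightarrow> cdf std_normal_distribution t"
proof -
  have "(\<lambda>m. cdf (scaled_binomial m) t) \<longlonglongrightarrow> cdf std_normal_distribution t"
    using weak_conv_scaled_binomial isCont_cdf_std_normal by (auto simp: weak_conv_m_def weak_conv_def)
  moreover have "filterlim (\<lambda>m. real m / 2 + sqrt (real m) / 2 * t) at_top sequentially" by real_asymp
  then have "\<forall>\<^sub>F m in sequentially. 0 \<le> real m / 2 + sqrt (real m) / 2 * t"
    by (auto simp: filterlim_at_top)
  then have "\<forall>\<^sub>F m in sequentially. cdf (scaled_binomial m) t =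
      RM_rate (nat (max \<lfloor>real m / 2 + sqrt (real m) / 2 * t\<rfloor> 0)) m"
    using eventually_gt_at_top[of 0] by eventually_elim (simp add: cdf_scaled_binomial max_def)
  ultimately show ?thesis by (rule Lim_transform_eventually)
qed

section \<open>Loss of rate when the length grows at fixed degree\<close>

lemma RM_rate_Suc: "RM_rate v m - RM_rate v (Suc m) = real (m choose v) / 2 ^ Suc m"
proof -
  \<comment> \<open>Pascal's rule counts each entry of row \<open>m\<close> twice, except the
    last.\<close>
  have "(\<Sum>k=0..v. real (Suc m choose k)) = 2 * (\<Sum>k=0..v. real (m choose k)) - real (m choose v)"
    by (induction v) (auto simp: algebra_simps)
  then show ?thesis by (simp add: RM_rate_def field_simps)
qed

text \<open>With b_n the normalised central coefficient, b_(n+1) = b_n (2n+1)/(2n+2). Since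
  (2n+1)(2n+3) is at most (2n+2)^2, the quantity b_n^2 (2n+1) does not increase from its initial
  value 1.\<close>

lemma central_binomial_le: "(real (2 * n choose n) / 4 ^ n)\<^sup>2 * (2 * real n + 1) \<le> 1"
proof (induction n)
  case (Suc n)
  let ?b = "\<lambda>n. real (2 * n choose n) / 4 ^ n"
  have 1: "(Suc (2 * n) choose Suc n) * Suc n = Suc (2 * n) * (2 * n choose n)"
    using Suc_times_binomial[of n "2 * n"] by (simp add: mult.commute)
  have "Suc (2 * n) choose n = Suc (2 * n) choose Suc n"
    using binomial_symmetric[of n "Suc (2 * n)"] by simp
  then have "2 * Suc n choose Suc n = 2 * (Suc (2 * n) choose Suc n)" by simp
  then have "real (2 * Suc n choose Suc n) * (real n + 1) = 2 * real (2 * n choose n) * (2 * real n + 1)"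
    using arg_cong[OF 1, of real] by (simp add: algebra_simps)
  moreover have "X / (4 * c) = Y / c * ((2 * real n + 1) / (2 * real n + 2))"
    if "X * (real n + 1) = 2 * Y * (2 * real n + 1)" "c > 0" for X Y c :: real
  proof -
    define q where "q = (2 * real n + 1) / (real n + 1)"
    have "X = 2 * Y * q" "(2 * real n + 1) / (2 * real n + 2) = q / 2"
      using that(1) by (simp_all add: q_def field_simps)
    then show ?thesis using that(2) by (simp only:) (simp add: field_simps)
  qed
  ultimately have step: "?b (Suc n) = ?b n * ((2 * real n + 1) / (2 * real n + 2))"
    unfolding power_Suc by simp
  have "(2 * real n + 1)\<^sup>2 * (2 * real n + 3) \<le> (2 * real n + 1) * (2 * real n + 2)\<^sup>2"
    by (simp add: power2_eq_square algebra_simps)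
  then have "((2 * real n + 1) / (2 * real n + 2))\<^sup>2 * (2 * real n + 3) \<le> 2 * real n + 1"
    unfolding power_divide times_divide_eq_left by (subst pos_divide_le_eq) auto
  then have "(?b n)\<^sup>2 * (((2 * real n + 1) / (2 * real n + 2))\<^sup>2 * (2 * real n + 3)) \<le> (?b n)\<^sup>2 * (2 * real n + 1)"
    by (intro mult_left_mono) auto
  moreover have "2 * real (Suc n) + 1 = 2 * real n + 3" by simp
  ultimately show ?case
    unfolding step power_mult_distrib mult.assoc using Suc by (simp only:)
qed simp

text \<open>The middle coefficient is the largest. For odd n = 2l+1, doubling it gives the central
  coefficient of row 2l+2, so the even case applies to l+1.\<close>

lemma binomial_over_power_le: "real (n choose k) / 2 ^ n \<le> 1 / sqrt (real n + 1)"
proof -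
  have even: "real (2 * l choose l) / 4 ^ l \<le> 1 / sqrt (2 * real l + 1)" for l
    using real_le_rsqrt[of "real (2 * l choose l) / 4 ^ l" "1 / (2 * real l + 1)"] central_binomial_le[of l]
    by (simp add: real_sqrt_divide field_simps)
  have "real (n choose k) / 2 ^ n \<le> real (n choose (n div 2)) / 2 ^ n"
    by (intro divide_right_mono) (auto intro: binomial_maximum)
  also have "\<dots> \<le> 1 / sqrt (real n + 1)"
  proof (cases "even n")
    case True
    then obtain l where "n = 2 * l" by auto
    then show ?thesis using even[of l] by (simp add: power_mult)
  next
    case False
    then obtain l where l: "n = Suc (2 * l)" by (auto elim: oddE)
    have "Suc (2 * l) choose l = Suc (2 * l) choose Suc l"
      using binomial_symmetric[of l "Suc (2 * l)"] by simp
    then have "real (2 * Suc l choose Suc l) = 2 * real (n choose l)" by (simp add: l)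
    then have "real (n choose (n div 2)) / 2 ^ n = real (2 * Suc l choose Suc l) / 4 ^ Suc l"
      by (simp add: l power_mult)
    also have "\<dots> \<le> 1 / sqrt (2 * real (Suc l) + 1)" by (rule even)
    also have "\<dots> \<le> 1 / sqrt (real n + 1)" by (intro divide_left_mono) (auto simp: l)
    finally show ?thesis .
  qed
  finally show ?thesis .
qed

lemma RM_rate_diff_le: "RM_rate v n - RM_rate v (n + j) \<le> real j / sqrt (real n + 1)"
proof (induction j)
  case (Suc j)
  have "RM_rate v (n + j) - RM_rate v (n + Suc j) = real (n + j choose v) / 2 ^ (n + j) / 2"
    using RM_rate_Suc[of v "n + j"] by simp
  also have "\<dots> \<le> real (n + j choose v) / 2 ^ (n + j)" by (simp add: field_simps)
  also have "\<dots> \<le> 1 / sqrt (real (n + j) + 1)" by (rule binomial_over_power_le)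
  also have "\<dots> \<le> 1 / sqrt (real n + 1)" by (intro divide_left_mono) auto
  finally show ?case using Suc by (simp add: add_divide_distrib)
qed simp

section \<open>Vanishing of the bit error probability\<close>

lemma bit_MAP_Pb_nonneg: "0 \<le> p \<Longrightarrow> p \<le> 1 \<Longrightarrow> 0 \<le> bit_MAP_Pb I C p"
  unfolding bit_MAP_Pb_def by (intro mult_nonneg_nonneg sum_nonneg) auto

lemma RM_bit_MAP_Pb_limit:
  assumes rate: "(\<lambda>m. RM_rate (v m) m) \<longlonglongrightarrow> r" and p: "0 \<le> p" "p < 1 - r" and r: "0 < r"
  shows "(\<lambda>m. bit_MAP_Pb (RM_coords m) (RM_code (v m) m) p) \<longlonglongrightarrow> 0"
proof (rule LIMSEQ_I)
  fix \<epsilon> :: real assume \<epsilon>: "\<epsilon> > 0"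
  \<comment> \<open>Half the gap to capacity: once the rate is below \<open>r + a\<close>, the
    factor \<open>1 - p - RM_rate (v m) m\<close> exceeds \<open>a\<close>.\<close>
  define a where "a = (1 - p - r) / 2"
  have a: "a > 0" using p by (simp add: a_def)
  have p1: "p \<le> 1" using p r by simp
  \<comment> \<open>The codimension is fixed first, to control the influence term; only then is
    \<open>m\<close> taken large, to control the loss of rate over \<open>j\<close> steps.\<close>
  obtain j :: nat where j: "(1 / 2) ^ j < \<epsilon> * a / 2"
    using real_arch_pow_inv[of "\<epsilon> * a / 2" "1 / 2"] \<epsilon> a by auto
  have "(\<lambda>n. real j / sqrt (real n + 1)) \<longlonglongrightarrow> 0" by real_asymp
  then have "(\<lambda>m. real j / sqrt (real (m - j) + 1)) \<longlonglongrightarrow> 0"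
    by (rule filterlim_compose[OF _ filterlim_minus_const_nat_at_top])
  then have "\<forall>\<^sub>F m in sequentially. real j / sqrt (real (m - j) + 1) < \<epsilon> * a / 2"
    using \<epsilon> a by (intro order_tendstoD(2)) auto
  moreover have "\<forall>\<^sub>F m in sequentially. RM_rate (v m) m < r + a"
    using a by (intro order_tendstoD(2)[OF rate]) auto
  moreover have "\<forall>\<^sub>F m in sequentially. j \<le> m" by (rule eventually_ge_at_top)
  ultimately have "\<forall>\<^sub>F m in sequentially. bit_MAP_Pb (RM_coords m) (RM_code (v m) m) p < \<epsilon>"
  proof eventually_elim
    case (elim m)
    have "RM_exit (v m) m p * a \<le> RM_exit (v m) m p * (1 - p - RM_rate (v m) m)"
      using elim RM_exit_bounds[OF p(1) p1, of "v m" m] by (intro mult_left_mono) (auto simp: a_def field_simps)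
    also have "\<dots> \<le> RM_rate (v m) (m - j) - RM_rate (v m) m + 2 ^ (m - j) / 2 ^ m"
      using p p1 by (intro RM_exit_sharp) auto
    also have "2 ^ (m - j) / 2 ^ m = (1 / 2 :: real) ^ j"
      using elim by (simp add: power_diff power_divide)
    also have "RM_rate (v m) (m - j) - RM_rate (v m) m + (1 / 2) ^ j < \<epsilon> * a"
    proof -
      have "RM_rate (v m) (m - j) - RM_rate (v m) m \<le> real j / sqrt (real (m - j) + 1)"
        using RM_rate_diff_le[of "v m" "m - j" j] elim(3) by simp
      then show ?thesis using elim(1) j by linarith
    qed
    finally have "RM_exit (v m) m p < \<epsilon>" using a by simp
    then show ?case using bit_MAP_Pb_le_RM_exit[OF p(1) p1, of m "v m"] by linarith
  qed
  then show "\<exists>n0. \<forall>m\<ge>n0. norm (bit_MAP_Pb (RM_coords m) (RM_code (v m) m) p - 0) < \<epsilon>"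
    by (simp add: eventually_sequentially bit_MAP_Pb_nonneg p p1)
qed

theorem theorem6:
  fixes r :: real and v :: "nat \<Rightarrow> nat"
  assumes "0 < r" "r < 1"
    and "\<And>m. v m = nat (max \<lfloor>real m / 2 + sqrt (real m) / 2 * Qinv (1 - r)\<rfloor> 0)"
  shows "(\<lambda>m. RM_rate (v m) m) \<longlonglongrightarrow> r \<and>
         capacity_achieving_BEC (\<lambda>m. RM_rate (v m) m)
           (\<lambda>m p. bit_MAP_Pb (RM_coords m) (RM_code (v m) m) p) r"
proof -
  have "cdf std_normal_distribution (Qinv (1 - r)) = r"
    using Qfun_Qinv[of "1 - r"] assms(1,2) by (simp add: Qfun_eq_cdf)
  then have rate: "(\<lambda>m. RM_rate (v m) m) \<longlonglongrightarrow> r"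
    using RM_rate_limit[of "Qinv (1 - r)"] by (simp add: assms(3))
  with RM_bit_MAP_Pb_limit[OF rate] assms(1) show ?thesis
    by (simp add: capacity_achieving_BEC_def)
qed

end
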